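(* Let $X$ and $Y$ be topological vector spaces, let $(T_n)_{n\ge 1}$ and $T$ be continuous linear maps from $X$ to $Y$, and let $D$ be a dense subset of $X$. Then the following statements are equivalent: (i) $T_n x\to Tx$ for all $x\in X$; (ii) $T_n x\to Tx$ for all $x\in D$, and the sequence $(T_n)$ is asymptotically equicontinuous.
   Context: A $0$-neighbourhood in a topological vector space is a neighbourhood of $0$. Given a set $X$ and a sequence $(F_n)$ of subsets of $X$, $\liminf_n F_n$ denotes the set of $x\in X$ that belong to $F_n$ for all but finitely many $n$. Definition. Let $X,Y$ be topological vector spaces, and let $(T_n)$ be a sequence of continuous linear maps from $X$ to $Y$. The sequence $(T_n)$ is asymptotically equicontinuous if, for each $0$-neighbourhood $V$ in $Y$, the set $\liminf_n T_n^{-1}(V)$ is a $0$-neighbourhood in $X$. Explicitly: for each $0$-neighbourhood $V$ in $Y$, there exists a $0$-neighbourhood $U$ in $X$ such that, whenever $x\in U$, then $T_nx\in V$ for all large enough $n$ (how large may depend on $x$). *)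

theory Defs
  imports "HOL-Analysis.Analysis"
begin

text \<open>
  Topological vector spaces are not assumed to be Hausdorff or locally convex. The scalar field
  is a type of class \<^class>\<open>real_normed_field\<close>: up to isomorphism of topological fields, the
  instances are exactly the real and the complex numbers. Continuity of addition is part of
  \<^class>\<open>topological_ab_group_add\<close>; the continuity of negation that this class also contains
  follows from that of scalar multiplication.
\<close>

locale topological_vector_space = vector_space scale
  for scale :: "'k::real_normed_field \<Rightarrow> 'a::topological_ab_group_add \<Rightarrow> 'a" +
  assumes continuous_scale: "continuous_on UNIV (\<lambda>(c, x). scale c x)"

definition zero_neighbourhood :: "'a::{zero, topological_space} set \<Rightarrow> bool" where
  "zero_neighbourhood V \<longleftrightarrow> (\<exists>U. open U \<and> 0 \<in> U \<and> U \<subseteq> V)"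

definition set_liminf :: "(nat \<Rightarrow> 'a set) \<Rightarrow> 'a set" where
  "set_liminf F = {x. \<forall>\<^sub>\<infinity>n. x \<in> F n}"

definition asymptotically_equicontinuous ::
  "(nat \<Rightarrow> 'a::{zero, topological_space} \<Rightarrow> 'b::{zero, topological_space}) \<Rightarrow> bool" where
  "asymptotically_equicontinuous T \<longleftrightarrow>
     (\<forall>V. zero_neighbourhood V \<longrightarrow> zero_neighbourhood (set_liminf (\<lambda>n. T n -` V)))"

end

theory Submission
  imports Defs
begin

text \<open>
  This is a three-epsilon argument. If \<open>T\<^sub>n \<rightarrow> T\<close> pointwise and \<open>V\<close> is an open set containing
  \<open>0\<close>, then \<open>x \<in> T\<inverse>(V)\<close> implies \<open>T\<^sub>n x \<in> V\<close> for all large \<open>n\<close>; so the \<open>0\<close>-neighbourhood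
  \<open>T\<inverse>(V)\<close> witnesses asymptotic equicontinuity. Conversely, for every \<open>d \<in> D\<close>,
  \[ T_n x - T x = T_n (x - d) + (T_n d - T d) + T (d - x). \]
  Choosing \<open>d\<close> close to \<open>x\<close> makes the last term small by continuity of \<open>T\<close>, and the first term
  small for all large \<open>n\<close> by asymptotic equicontinuity; with \<open>d\<close> now fixed, the middle term is
  small for all large \<open>n\<close> by convergence on \<open>D\<close>. It does not matter that ``large'' depends on
  the point \<open>x - d\<close>, because only one such point occurs.
\<close>

lemma asymptotically_equicontinuous_if_pointwise_limit:
  fixes T :: "'a::{zero, topological_space} \<Rightarrow> 'b::{zero, topological_space}"
  assumes lim: "\<And>x. (\<lambda>n. Tn n x) \<longlonglongrightarrow> T x"
    and cont: "continuous_on UNIV T"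
    and zero: "T 0 = 0"
  shows "asymptotically_equicontinuous Tn"
  unfolding asymptotically_equicontinuous_def
proof (intro allI impI)
  fix V :: "'b set"
  assume "zero_neighbourhood V"
  then obtain W where W: "open W" "0 \<in> W" "W \<subseteq> V"
    by (auto simp: zero_neighbourhood_def)
  have "open (T -` W)"
    using cont W(1) by (simp add: open_vimage)
  moreover have "0 \<in> T -` W"
    using zero W(2) by simp
  moreover have "T -` W \<subseteq> set_liminf (\<lambda>n. Tn n -` V)"
  proof
    fix x
    assume "x \<in> T -` W"
    then have "\<forall>\<^sub>F n in sequentially. Tn n x \<in> W"
      using topological_tendstoD[OF lim W(1)] by simp
    then have "\<forall>\<^sub>F n in sequentially. Tn n x \<in> V"
      by (rule eventually_mono) (use W(3) in blast)
    then show "x \<in> set_liminf (\<lambda>n. Tn n -` V)"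
      by (simp add: set_liminf_def cofinite_eq_sequentially)
  qed
  ultimately show "zero_neighbourhood (set_liminf (\<lambda>n. Tn n -` V))"
    unfolding zero_neighbourhood_def by blast
qed

text \<open>
  Continuity of addition at the origin replaces the division of \<open>\<epsilon>\<close> into three parts.
\<close>

lemma zero_neighbourhood_three_summands:
  fixes V :: "'a::topological_ab_group_add set"
  assumes "open V" "0 \<in> V"
  obtains A where "open A" "0 \<in> A"
    "\<And>a b c. a \<in> A \<Longrightarrow> b \<in> A \<Longrightarrow> c \<in> A \<Longrightarrow> a + b + c \<in> V"
proof -
  let ?sum = "\<lambda>(a, b, c). a + b + c :: 'a"
  have "open (?sum -` V)"
    using assms(1) unfolding case_prod_unfold
    by (intro open_vimage) (auto intro!: continuous_intros)
  moreover have "(0, 0, 0) \<in> ?sum -` V"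
    using assms(2) by simp
  ultimately obtain A R where AR: "open A" "open R" "(0, 0, 0) \<in> A \<times> R" "A \<times> R \<subseteq> ?sum -` V"
    by (rule open_prod_elim)
  obtain B C where BC: "open B" "open C" "(0, 0) \<in> B \<times> C" "B \<times> C \<subseteq> R"
    using AR(2,3) by (auto elim: open_prod_elim)
  show thesis
  proof (rule that)
    show "open (A \<inter> B \<inter> C)" "0 \<in> A \<inter> B \<inter> C"
      using AR BC by auto
    show "a + b + c \<in> V" if "a \<in> A \<inter> B \<inter> C" "b \<in> A \<inter> B \<inter> C" "c \<in> A \<inter> B \<inter> C" for a b c
    proof -
      have "(a, b, c) \<in> A \<times> R"
        using that BC(4) by blast
      then show ?thesis
        using AR(4) by auto
    qed
  qed
qed

text \<open>
  Additivity is only asked of almost all \<open>Tn n\<close>, since finitely many terms affect neither the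
  limit nor asymptotic equicontinuity.
\<close>

lemma pointwise_limit_if_asymptotically_equicontinuous:
  fixes T :: "'a::topological_ab_group_add \<Rightarrow> 'b::topological_ab_group_add"
  assumes add_Tn: "\<forall>\<^sub>F n in sequentially. \<forall>x y. Tn n (x + y) = Tn n x + Tn n y"
    and add_T: "\<And>x y. T (x + y) = T x + T y"
    and cont: "continuous_on UNIV T"
    and dense: "closure D = UNIV"
    and lim: "\<And>d. d \<in> D \<Longrightarrow> (\<lambda>n. Tn n d) \<longlonglongrightarrow> T d"
    and equi: "asymptotically_equicontinuous Tn"
  shows "(\<lambda>n. Tn n x) \<longlonglongrightarrow> T x"
proof (rule topological_tendstoI)
  fix W
  assume W: "open W" "T x \<in> W"
  have "open ((\<lambda>v. v + T x) -` W)"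
    using W(1) by (intro open_vimage) (auto intro!: continuous_intros)
  moreover have "0 \<in> (\<lambda>v. v + T x) -` W"
    using W(2) by simp
  ultimately obtain A where A: "open A" "0 \<in> A"
    and sum: "\<And>a b c. a \<in> A \<Longrightarrow> b \<in> A \<Longrightarrow> c \<in> A \<Longrightarrow> a + b + c \<in> (\<lambda>v. v + T x) -` W"
    by (rule zero_neighbourhood_three_summands) blast
  have "zero_neighbourhood A"
    using A by (auto simp: zero_neighbourhood_def)
  then have "zero_neighbourhood (set_liminf (\<lambda>n. Tn n -` A))"
    using equi by (simp add: asymptotically_equicontinuous_def)
  then obtain U where U: "open U" "0 \<in> U" "U \<subseteq> set_liminf (\<lambda>n. Tn n -` A)"
    by (auto simp: zero_neighbourhood_def)
  have T0: "T 0 = 0"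
    using add_T[of 0 0] by simp
  \<comment> \<open>The points \<open>y\<close> for which \<open>T\<^sub>n (x - y)\<close> and \<open>T (y - x)\<close> are both under control.\<close>
  let ?N = "(\<lambda>y. x - y) -` U \<inter> (\<lambda>y. T (y - x)) -` A"
  have "open ?N"
    using U(1) A(1)
    by (intro open_Int open_vimage continuous_on_compose2[OF cont])
       (auto intro!: continuous_intros)
  moreover have "x \<in> ?N"
    using U(2) A(2) T0 by simp
  ultimately have "?N \<inter> D \<noteq> {}"
    using dense open_Int_closure_eq_empty[of ?N D] by blast
  then obtain d where d: "d \<in> D" "x - d \<in> U" "T (d - x) \<in> A"
    by blast
  have Td: "T d = T (d - x) + T x"
    using add_T[of "d - x" x] by simp
  have first: "\<forall>\<^sub>F n in sequentially. Tn n (x - d) \<in> A"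
    using U(3) d(2) by (auto simp: set_liminf_def cofinite_eq_sequentially)
  have "(\<lambda>n. Tn n d - T d) \<longlonglongrightarrow> T d - T d"
    using lim[OF d(1)] by (intro tendsto_intros)
  then have middle: "\<forall>\<^sub>F n in sequentially. Tn n d - T d \<in> A"
    using topological_tendstoD A by fastforce
  show "\<forall>\<^sub>F n in sequentially. Tn n x \<in> W"
    using add_Tn first middle
  proof eventually_elim
    case (elim n)
    have "Tn n x = Tn n (x - d) + Tn n d"
      using elim(1)[rule_format, of "x - d" d] by simp
    then have "Tn n x = Tn n (x - d) + (Tn n d - T d) + T (d - x) + T x"
      using Td by (simp add: algebra_simps)
    then show ?case
      using sum[OF elim(2,3) d(3)] by simp
  qed
qed

theorem theorem2p2:
  fixes scaleX :: "'k::real_normed_field \<Rightarrow> 'a::topological_ab_group_add \<Rightarrow> 'a"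
    and scaleY :: "'k \<Rightarrow> 'b::topological_ab_group_add \<Rightarrow> 'b"
    and Tn :: "nat \<Rightarrow> 'a \<Rightarrow> 'b"
    and T :: "'a \<Rightarrow> 'b"
    and D :: "'a set"
  assumes "topological_vector_space scaleX"
    and "topological_vector_space scaleY"
    and "\<And>n. n \<ge> 1 \<Longrightarrow> Vector_Spaces.linear scaleX scaleY (Tn n)"
    and "\<And>n. n \<ge> 1 \<Longrightarrow> continuous_on UNIV (Tn n)"
    and "Vector_Spaces.linear scaleX scaleY T"
    and "continuous_on UNIV T"
    and "closure D = UNIV"
  shows "(\<forall>x. (\<lambda>n. Tn n x) \<longlonglongrightarrow> T x) \<longleftrightarrow>
         (\<forall>x\<in>D. (\<lambda>n. Tn n x) \<longlonglongrightarrow> T x) \<and> asymptotically_equicontinuous Tn"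
proof -
  have additive: "S (x + y) = S x + S y" if "Vector_Spaces.linear scaleX scaleY S" for S x y
    using that by (simp add: Vector_Spaces.linear_iff)
  have add_T: "T (x + y) = T x + T y" for x y
    using assms(5) by (rule additive)
  have T0: "T 0 = 0"
    using add_T[of 0 0] by simp
  \<comment> \<open>The sequence starts at index 1, so \<open>Tn 0\<close> is an arbitrary function.\<close>
  have add_Tn: "\<forall>\<^sub>F n in sequentially. \<forall>x y. Tn n (x + y) = Tn n x + Tn n y"
    using eventually_ge_at_top[of 1] by eventually_elim (use assms(3) additive in blast)
  show ?thesis
    using asymptotically_equicontinuous_if_pointwise_limit[of Tn T, OF _ assms(6) T0]
      pointwise_limit_if_asymptotically_equicontinuous[OF add_Tn add_T assms(6,7)]
    by blast
qed

end
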